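(* Let $\{R_1,R_2\}$ be a pair of commuting Rota-Baxter operators (of weight zero) on a pre-Lie algebra $(A,\circ)$. Then there exists an L-quadri-algebra structure on $A$ defined, for $x,y\in A$, by $$x\searrow y=R_1R_2(x)\circ y,\quad x\nwarrow y=-R_1(y)\circ R_2(x),\quad x\nearrow y=-y\circ R_1R_2(x),\quad x\swarrow y=R_2(x)\circ R_1(y).$$
   Context: All algebras are finite-dimensional over a field of characteristic zero. A pre-Lie algebra $(A,\circ)$ is a vector space with a bilinear product such that $(x\circ y)\circ z-x\circ(y\circ z)=(y\circ x)\circ z-y\circ(x\circ z)$ for all $x,y,z$. A Rota-Baxter operator (of weight zero) on it is a linear map $R:A\to A$ with $R(x)\circ R(y)=R(R(x)\circ y+x\circ R(y))$ for all $x,y\in A$. An L-quadri-algebra $(A,\searrow,\nearrow,\nwarrow,\swarrow)$ is a vector space with four bilinear products such that for all $x,y,z\in A$: $x\searrow(y\searrow z)-(x\ast y)\searrow z=y\searrow(x\searrow z)-(y\ast x)\searrow z$; $x\searrow(y\nearrow z)-(x\vee y)\nearrow z=y\nearrow(x\succ z)-(y\wedge x)\nearrow z$; $x\searrow(y\nwarrow z)-(x\searrow y)\nwarrow z=y\nwarrow(x\ast z)-(y\nwarrow x)\nwarrow z$; $x\nearrow(y\prec z)-(x\nearrow y)\nwarrow z=y\swarrow(x\wedge z)-(y\swarrow x)\nwarrow z$; $x\searrow(y\swarrow z)-(x\succ y)\swarrow z=y\swarrow(x\vee z)-(y\prec x)\swarrow z$; where $x\succ y=x\searrow y+x\nearrow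 y$, $x\prec y=x\nwarrow y+x\swarrow y$, $x\vee y=x\searrow y+x\swarrow y$, $x\wedge y=x\nearrow y+x\nwarrow y$, $x\ast y=x\searrow y+x\nearrow y+x\nwarrow y+x\swarrow y$. *)

theory Defs
  imports Complex_Main
begin

locale fin_dim_space = vector_space scale
  for scale :: "'k::field_char_0 \<Rightarrow> 'a::ab_group_add \<Rightarrow> 'a" +
  assumes finite_dimensional: "\<exists>B. finite B \<and> span B = UNIV"

definition bilinear_product ::
    "('k::field \<Rightarrow> 'a::ab_group_add \<Rightarrow> 'a) \<Rightarrow> ('a \<Rightarrow> 'a \<Rightarrow> 'a) \<Rightarrow> bool" where
  "bilinear_product scale m \<longleftrightarrow>
     (\<forall>x. Vector_Spaces.linear scale scale (\<lambda>y. m x y)) \<and>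
     (\<forall>y. Vector_Spaces.linear scale scale (\<lambda>x. m x y))"

locale pre_Lie_algebra = fin_dim_space scale
  for scale :: "'k::field_char_0 \<Rightarrow> 'a::ab_group_add \<Rightarrow> 'a" +
  fixes mult :: "'a \<Rightarrow> 'a \<Rightarrow> 'a" (infixl \<open>\<bullet>\<close> 70)
  assumes bilinear_mult: "bilinear_product scale mult"
    and left_symmetric: "(x \<bullet> y) \<bullet> z - x \<bullet> (y \<bullet> z) = (y \<bullet> x) \<bullet> z - y \<bullet> (x \<bullet> z)"

text \<open>The operators considered here have weight zero.\<close>

locale Rota_Baxter_operator = pre_Lie_algebra scale mult
  for scale :: "'k::field_char_0 \<Rightarrow> 'a::ab_group_add \<Rightarrow> 'a"
    and mult :: "'a \<Rightarrow> 'a \<Rightarrow> 'a" (infixl \<open>\<bullet>\<close> 70) +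
  fixes R :: "'a \<Rightarrow> 'a"
  assumes linear_R: "Vector_Spaces.linear scale scale R"
    and Rota_Baxter: "R x \<bullet> R y = R (R x \<bullet> y + x \<bullet> R y)"

text \<open>
  The products are passed in the order south-east, north-east, north-west, south-west,
  which is the order of the tuple in the definition of an L-quadri-algebra.
\<close>

locale four_products =
  fixes se :: "'a::ab_group_add \<Rightarrow> 'a \<Rightarrow> 'a" (infixl \<open>\<searrow>\<close> 70)
    and ne :: "'a \<Rightarrow> 'a \<Rightarrow> 'a" (infixl \<open>\<nearrow>\<close> 70)
    and nw :: "'a \<Rightarrow> 'a \<Rightarrow> 'a" (infixl \<open>\<nwarrow>\<close> 70)
    and sw :: "'a \<Rightarrow> 'a \<Rightarrow> 'a" (infixl \<open>\<swarrow>\<close> 70)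
begin

definition succ :: "'a \<Rightarrow> 'a \<Rightarrow> 'a" (infixl \<open>\<succ>\<close> 70) where
  "x \<succ> y = x \<searrow> y + x \<nearrow> y"

definition prec :: "'a \<Rightarrow> 'a \<Rightarrow> 'a" (infixl \<open>\<prec>\<close> 70) where
  "x \<prec> y = x \<nwarrow> y + x \<swarrow> y"

definition vee :: "'a \<Rightarrow> 'a \<Rightarrow> 'a" (infixl \<open>\<^bold>\<or>\<close> 70) where
  "x \<^bold>\<or> y = x \<searrow> y + x \<swarrow> y"

definition wedge :: "'a \<Rightarrow> 'a \<Rightarrow> 'a" (infixl \<open>\<^bold>\<and>\<close> 70) where
  "x \<^bold>\<and> y = x \<nearrow> y + x \<nwarrow> y"

definition ast :: "'a \<Rightarrow> 'a \<Rightarrow> 'a" (infixl \<open>\<star>\<close> 70) where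
  "x \<star> y = x \<searrow> y + x \<nearrow> y + x \<nwarrow> y + x \<swarrow> y"

end

locale L_quadri_algebra = fin_dim_space scale + four_products se ne nw sw
  for scale :: "'k::field_char_0 \<Rightarrow> 'a::ab_group_add \<Rightarrow> 'a"
    and se :: "'a \<Rightarrow> 'a \<Rightarrow> 'a" (infixl \<open>\<searrow>\<close> 70)
    and ne :: "'a \<Rightarrow> 'a \<Rightarrow> 'a" (infixl \<open>\<nearrow>\<close> 70)
    and nw :: "'a \<Rightarrow> 'a \<Rightarrow> 'a" (infixl \<open>\<nwarrow>\<close> 70)
    and sw :: "'a \<Rightarrow> 'a \<Rightarrow> 'a" (infixl \<open>\<swarrow>\<close> 70) +
  assumes bilinear_se: "bilinear_product scale se"
    and bilinear_ne: "bilinear_product scale ne"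
    and bilinear_nw: "bilinear_product scale nw"
    and bilinear_sw: "bilinear_product scale sw"
    and L_quadri_1:
      "x \<searrow> (y \<searrow> z) - (x \<star> y) \<searrow> z = y \<searrow> (x \<searrow> z) - (y \<star> x) \<searrow> z"
    and L_quadri_2:
      "x \<searrow> (y \<nearrow> z) - (x \<^bold>\<or> y) \<nearrow> z = y \<nearrow> (x \<succ> z) - (y \<^bold>\<and> x) \<nearrow> z"
    and L_quadri_3:
      "x \<searrow> (y \<nwarrow> z) - (x \<searrow> y) \<nwarrow> z = y \<nwarrow> (x \<star> z) - (y \<nwarrow> x) \<nwarrow> z"
    and L_quadri_4:
      "x \<nearrow> (y \<prec> z) - (x \<nearrow> y) \<nwarrow> z = y \<swarrow> (x \<^bold>\<and> z) - (y \<swarrow> x) \<nwarrow> z"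
    and L_quadri_5:
      "x \<searrow> (y \<swarrow> z) - (x \<succ> y) \<swarrow> z = y \<swarrow> (x \<^bold>\<or> z) - (y \<prec> x) \<swarrow> z"

end

theory Submission
  imports Defs
begin

text \<open>
  Write \<open>P = R1 \<circ> R2 = R2 \<circ> R1\<close>. Expanding \<open>P x \<bullet> P y\<close> with the Rota-Baxter identities of
  \<open>R1\<close> and \<open>R2\<close> in turn gives
  \<open>P x \<bullet> P y = P (P x \<bullet> y + R2 x \<bullet> R1 y + R1 x \<bullet> R2 y + x \<bullet> P y)\<close>,
  while each mixed product \<open>P x \<bullet> R2 y\<close>, \<open>P x \<bullet> R1 y\<close> (in either order) is a single
  Rota-Baxter identity. These identities turn each L-quadri-algebra axiom into one instance of
  left symmetry: for \<open>(P x, P y, z)\<close>, \<open>(P x, z, P y)\<close>, \<open>(P x, R1 z, R2 y)\<close>,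
  \<open>(R1 z, R2 y, P x)\<close> and \<open>(P x, R2 y, R1 z)\<close>, respectively.
\<close>

context fin_dim_space
begin

lemma bilinear_product_iff:
  "bilinear_product scale m \<longleftrightarrow>
     (\<forall>x y z. m (x + y) z = m x z + m y z) \<and> (\<forall>x y z. m x (y + z) = m x y + m x z) \<and>
     (\<forall>c x y. m (scale c x) y = scale c (m x y)) \<and>
     (\<forall>c x y. m x (scale c y) = scale c (m x y))"
  unfolding bilinear_product_def Vector_Spaces.linear_iff
  using vector_space_axioms by blast

end

context pre_Lie_algebra
begin

lemma mult_add_left: "(x + y) \<bullet> z = x \<bullet> z + y \<bullet> z"
  and mult_add_right: "x \<bullet> (y + z) = x \<bullet> y + x \<bullet> z"
  and mult_scale_left: "scale c x \<bullet> y = scale c (x \<bullet> y)"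
  and mult_scale_right: "x \<bullet> scale c y = scale c (x \<bullet> y)"
  using bilinear_mult unfolding bilinear_product_iff by blast+

lemma mult_minus_left: "(- x) \<bullet> y = - (x \<bullet> y)"
  using mult_scale_left[of "- 1" x y] by simp

lemma mult_minus_right: "x \<bullet> (- y) = - (x \<bullet> y)"
  using mult_scale_right[of x "- 1" y] by simp

lemma mult_diff_left: "(x - y) \<bullet> z = x \<bullet> z - y \<bullet> z"
  using mult_add_left[of x "- y" z] by (simp add: mult_minus_left)

lemma mult_diff_right: "x \<bullet> (y - z) = x \<bullet> y - x \<bullet> z"
  using mult_add_right[of x y "- z"] by (simp add: mult_minus_right)

lemmas mult_simps =
  mult_add_left mult_add_right mult_minus_left mult_minus_right mult_diff_left mult_diff_right

end

context Rota_Baxter_operator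
begin

lemma R_add: "R (x + y) = R x + R y"
  and R_scale: "R (scale c x) = scale c (R x)"
  using linear_R unfolding Vector_Spaces.linear_iff by blast+

lemma R_minus: "R (- x) = - R x"
  using R_scale[of "- 1" x] by simp

lemma R_diff: "R (x - y) = R x - R y"
  using R_add[of x "- y"] by (simp add: R_minus)

lemma R_mult: "R (R x \<bullet> y) + R (x \<bullet> R y) = R x \<bullet> R y"
  by (simp add: Rota_Baxter R_add)

lemmas R_simps = R_add R_minus R_diff

end

theorem corollary3p14:
  fixes scale :: "'k::field_char_0 \<Rightarrow> 'a::ab_group_add \<Rightarrow> 'a"
    and mult :: "'a \<Rightarrow> 'a \<Rightarrow> 'a" (infixl \<open>\<bullet>\<close> 70)
    and R1 R2 :: "'a \<Rightarrow> 'a"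
  assumes "pre_Lie_algebra scale mult"
    and "Rota_Baxter_operator scale mult R1"
    and "Rota_Baxter_operator scale mult R2"
    and "R1 \<circ> R2 = R2 \<circ> R1"
  shows "L_quadri_algebra scale
           (\<lambda>x y. R1 (R2 x) \<bullet> y)
           (\<lambda>x y. - (y \<bullet> R1 (R2 x)))
           (\<lambda>x y. - (R1 y \<bullet> R2 x))
           (\<lambda>x y. R2 x \<bullet> R1 y)"
proof -
  interpret A1: Rota_Baxter_operator scale mult R1 by fact
  interpret A2: Rota_Baxter_operator scale mult R2 by fact
  \<comment> \<open>As an opaque atom, \<open>P\<close> gives both compositions one normal
    form.\<close>
  define P where "P x = R1 (R2 x)" for x
  have R2_R1: "R2 (R1 x) = P x" for x
    using assms(4) by (metis P_def comp_apply)
  note R1_R2 = P_def[symmetric]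
  note bilin = A1.mult_simps A1.R_simps A2.R_simps
  have R2_P: "R2 (P x \<bullet> y) + R2 (R1 x \<bullet> R2 y) = P x \<bullet> R2 y"
    "R2 (x \<bullet> P y) + R2 (R2 x \<bullet> R1 y) = R2 x \<bullet> P y" for x y
    using A2.R_mult[of "R1 x" y] A2.R_mult[of x "R1 y"] by (simp_all add: R2_R1 add.commute)
  have R1_P: "R1 (P x \<bullet> y) + R1 (R2 x \<bullet> R1 y) = P x \<bullet> R1 y"
    "R1 (x \<bullet> P y) + R1 (R1 x \<bullet> R2 y) = R1 x \<bullet> P y" for x y
    using A1.R_mult[of "R2 x" y] A1.R_mult[of x "R2 y"] by (simp_all add: R1_R2 add.commute)
  have P_mult: "P x \<bullet> P y =
      P (P x \<bullet> y) + P (R2 x \<bullet> R1 y) + P (R1 x \<bullet> R2 y) + P (x \<bullet> P y)" for x y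
  proof -
    have "P x \<bullet> P y = R1 (P x \<bullet> R2 y) + R1 (R2 x \<bullet> P y)"
      using A1.R_mult[of "R2 x" "R2 y"] by (simp add: R1_R2)
    also have "\<dots> = R1 (R2 (P x \<bullet> y) + R2 (R1 x \<bullet> R2 y)) + R1 (R2 (x \<bullet> P y) + R2 (R2 x \<bullet> R1 y))"
      by (simp only: R2_P)
    finally show ?thesis
      by (simp add: A1.R_add R1_R2 algebra_simps)
  qed
  have P_add: "P (x + y) = P x + P y" and P_minus: "P (- x) = - P x"
    and P_diff: "P (x - y) = P x - P y" for x y
    by (simp_all add: P_def bilin)
  note bilin = bilin P_add P_minus P_diff
  have P_scale: "P (scale c x) = scale c (P x)" for c x
    by (simp add: P_def A1.R_scale A2.R_scale)
  note scales = A1.mult_scale_left A1.mult_scale_right A1.R_scale A2.R_scale P_scale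
  note products = four_products.succ_def four_products.prec_def four_products.vee_def
    four_products.wedge_def four_products.ast_def
  \<comment> \<open>Products of operator values become sums of operator images of products, the
    shape in which the axioms contain them, so that only additive cancellation remains.\<close>
  note expand = products bilin P_mult R1_P[symmetric] R2_P[symmetric] algebra_simps
  have "L_quadri_algebra scale (\<lambda>x y. P x \<bullet> y) (\<lambda>x y. - (y \<bullet> P x))
      (\<lambda>x y. - (R1 y \<bullet> R2 x)) (\<lambda>x y. R2 x \<bullet> R1 y)"
  \<comment> \<open>Goals 1 to 4 are bilinearity, left to the closing \<open>qed\<close>; goals 5 to
    9 are the five axioms.\<close>
  proof (unfold_locales, goal_cases)
    case (5 x y z)
    show ?case
      \<comment> \<open>\<open>P\<close> maps x * y - y * x, for the sum * of all four products, to
        the commutator of \<open>P x\<close> and \<open>P y\<close>.\<close>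
      using A1.left_symmetric[of "P x" "P y" z] by (simp add: expand)
  next
    case (6 x y z)
    show ?case
      \<comment> \<open>By \<open>P_mult\<close>, \<open>P\<close> maps the difference of x vee y
        and y wedge x to \<open>P x \<bullet> P y\<close>.\<close>
      using A1.left_symmetric[of "P x" z "P y"] by (simp add: expand)
  next
    case (7 x y z)
    show ?case
      \<comment> \<open>\<open>R1\<close> of the total product of x and z is the commutator of
        \<open>P x\<close> and \<open>R1 z\<close>.\<close>
      using A1.left_symmetric[of "P x" "R1 z" "R2 y"] by (simp add: expand)
  next
    case (8 x y z)
    show ?case
      using A1.left_symmetric[of "R1 z" "R2 y" "P x"] by (simp add: expand)
  next
    case (9 x y z)
    show ?case
      using A1.left_symmetric[of "P x" "R2 y" "R1 z"] by (simp add: expand)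
  qed (simp_all add: A1.bilinear_product_iff bilin scales)
  then show ?thesis
    by (simp only: P_def)
qed

end
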